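(* Let $p\colon\mathbb{R}\to\mathbb{R}$ be bounded and uniformly continuous, and assume that the equation $x'=-x^2+p(t)$ has exactly two hyperbolic solutions. Then, for every $c>0$, the following three cases exhaust the dynamical possibilities for the equation $$y'=-\Big(y-\frac{2}{\pi}\arctan(ct)\Big)^2+p(t):$$ Case A: it has two different hyperbolic solutions; Case B: it has exactly one bounded solution; Case C: it has no bounded solutions.
   Context: "Bounded solution" means a solution defined and bounded on all of $\mathbb{R}$. For a scalar equation $x'=h(t,x)$ with $h$ and $\partial h/\partial x$ continuous, a globally defined solution $\tilde b\colon\mathbb{R}\to\mathbb{R}$ is hyperbolic if there are $k\ge1$, $\beta>0$ such that either $\exp\int_s^t\frac{\partial h}{\partial x}(l,\tilde b(l))\,dl\le k\,e^{-\beta(t-s)}$ whenever $t\ge s$ (attractive), or $\exp\int_s^t\frac{\partial h}{\partial x}(l,\tilde b(l))\,dl\le k\,e^{\beta(t-s)}$ whenever $t\le s$ (repulsive). *)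

theory Defs
  imports "HOL-Analysis.Analysis"
begin

definition global_solution :: "(real \<Rightarrow> real \<Rightarrow> real) \<Rightarrow> (real \<Rightarrow> real) \<Rightarrow> bool" where
  "global_solution h b \<longleftrightarrow> (\<forall>t. (b has_real_derivative h t (b t)) (at t))"

definition bounded_solution :: "(real \<Rightarrow> real \<Rightarrow> real) \<Rightarrow> (real \<Rightarrow> real) \<Rightarrow> bool" where
  "bounded_solution h b \<longleftrightarrow> global_solution h b \<and> bounded (range b)"

(* The two conditions below are meant for h and its partial derivative in the second argument
   continuous.  LBINT l=s..t is the oriented integral, so for t < s it is minus the integral
   over [t, s]. *)

definition attractive_along :: "(real \<Rightarrow> real \<Rightarrow> real) \<Rightarrow> (real \<Rightarrow> real) \<Rightarrow> real \<Rightarrow> real \<Rightarrow> bool" where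
  "attractive_along h b k \<beta> \<longleftrightarrow>
     (\<forall>s t. t \<ge> s \<longrightarrow> exp (LBINT l=s..t. deriv (h l) (b l)) \<le> k * exp (- \<beta> * (t - s)))"

definition repulsive_along :: "(real \<Rightarrow> real \<Rightarrow> real) \<Rightarrow> (real \<Rightarrow> real) \<Rightarrow> real \<Rightarrow> real \<Rightarrow> bool" where
  "repulsive_along h b k \<beta> \<longleftrightarrow>
     (\<forall>s t. t \<le> s \<longrightarrow> exp (LBINT l=s..t. deriv (h l) (b l)) \<le> k * exp (\<beta> * (t - s)))"

definition hyperbolic_solution :: "(real \<Rightarrow> real \<Rightarrow> real) \<Rightarrow> (real \<Rightarrow> real) \<Rightarrow> bool" where
  "hyperbolic_solution h b \<longleftrightarrow> global_solution h b \<and>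
     (\<exists>k \<beta>. k \<ge> 1 \<and> \<beta> > 0 \<and> (attractive_along h b k \<beta> \<or> repulsive_along h b k \<beta>))"

end

theory Submission
  imports Defs "HOL-Real_Asymp.Real_Asymp"
begin

text \<open>
  The three cases exhaust all possibilities as soon as two different bounded solutions of the
  transition equation force two different hyperbolic ones.  With \<open>\<Gamma>(t) = (2/\<pi>) arctan (c t)\<close>, the
  substitution \<open>x = y - \<Gamma>\<close> turns the equation into \<open>x' = -x\<^sup>2 + q\<close> with \<open>q = p - \<Gamma>'\<close>, where \<open>\<Gamma>'\<close> is
  positive and tends to zero at both ends of the time axis.  So the question is what a decaying
  perturbation can do to the equation \<open>x' = -x\<^sup>2 + p\<close>.

  Hyperbolicity is handled through uniform separation.  Two hyperbolic solutions of a Riccati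
  equation are a repulsive \<open>r\<close> below an attractive \<open>a\<close>, and \<open>a - r\<close> is bounded away from zero
  (\<open>hyperbolic_solutions_separated\<close>); conversely, two solutions at a distance bounded above and away
  from zero are both hyperbolic (\<open>separated_solutions_hyperbolic\<close>).  It remains to find a uniformly
  separated pair for \<open>q\<close>, given one for \<open>p\<close> and two different global solutions for \<open>q\<close>.

  In the coordinate \<open>\<theta> = (x - r)/(a - r)\<close> the perturbed equation reads
  \<open>\<theta>' = (a - r) \<theta> (1 - \<theta>) - (p - q)/(a - r)\<close>, and global solutions satisfy \<open>0 \<le> \<theta> \<le> 1\<close>.  For
  large times a solution either stays below 1/4 or ends up above 3/4, and of two solutions the upper
  one ends up above 3/4, since two low ones would drift apart.  Below any given solution that is not
  the lowest one there is a lowest solution, given explicitly by the Bernoulli transformation, and it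
  must stay low in the future, for otherwise it would approach the upper solution so fast that there
  would be room for a still lower one (\<open>eventually_low_solution\<close>).  Reversing time gives an upper
  solution that is high in the past.  The two solutions obtained this way are far apart at both ends
  (\<open>separated_pair\<close>), hence uniformly separated.
\<close>

section \<open>Linear differential inequalities\<close>

lemma antiderivative_exists:
  fixes f :: "real \<Rightarrow> real"
  assumes "continuous_on UNIV f"
  obtains F where "\<And>t. (F has_real_derivative f t) (at t)"
proof -
  have "\<exists>F. \<forall>x::real. -\<infinity> < ereal x \<longrightarrow> ereal x < \<infinity> \<longrightarrow> (F has_vector_derivative f x) (at x)"
    using assms by (intro einterval_antiderivative) (auto simp: continuous_on_eq_continuous_at)
  then show ?thesis
    using that by (auto simp: has_real_derivative_iff_has_vector_derivative)
qed

text \<open>The comparison principle for linear equations: an integrating factor makes \<open>f\<close> times a positive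
  function nondecreasing.  In particular \<open>f\<close> cannot lose its sign, neither strict nor weak, once
  \<open>f t0\<close> is positive or nonnegative.\<close>

lemma linear_lower_bound:
  fixes f f' k :: "real \<Rightarrow> real"
  assumes f: "\<And>t. t0 \<le> t \<Longrightarrow> (f has_real_derivative f' t) (at t)"
    and le: "\<And>t. t0 \<le> t \<Longrightarrow> k t * f t \<le> f' t"
    and k: "continuous_on UNIV k"
    and "t0 \<le> t1"
  obtains C where "C > 0" "C * f t0 \<le> f t1"
proof -
  obtain K where K: "\<And>t. (K has_real_derivative k t) (at t)"
    using antiderivative_exists[OF k] by blast
  have "f t0 * exp (- K t0) \<le> f t1 * exp (- K t1)"
  proof (rule DERIV_nonneg_imp_nondecreasing[OF \<open>t0 \<le> t1\<close>])
    fix t assume t: "t0 \<le> t"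
    have "((\<lambda>t. f t * exp (- K t)) has_real_derivative (f' t - k t * f t) * exp (- K t)) (at t)"
      by (rule derivative_eq_intros f[OF t] K refl)+ (simp add: algebra_simps)
    moreover have "(f' t - k t * f t) * exp (- K t) \<ge> 0"
      using le[OF t] by simp
    ultimately show "\<exists>y. ((\<lambda>t. f t * exp (- K t)) has_real_derivative y) (at t) \<and> 0 \<le> y"
      by blast
  qed
  then have "f t0 * exp (- K t0) * exp (K t1) \<le> f t1 * exp (- K t1) * exp (K t1)"
    by (rule mult_right_mono) simp
  then have "exp (K t1 - K t0) * f t0 \<le> f t1"
    by (simp add: exp_diff exp_minus field_simps)
  then show ?thesis
    using that[of "exp (K t1 - K t0)"] by simp
qed

lemma derivative_ge_pos_unbounded:
  fixes f f' :: "real \<Rightarrow> real"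
  assumes f: "\<And>t. t0 \<le> t \<Longrightarrow> (f has_real_derivative f' t) (at t)"
    and le: "\<And>t. t0 \<le> t \<Longrightarrow> e \<le> f' t"
    and "e > 0" and B: "\<And>t. t0 \<le> t \<Longrightarrow> f t \<le> B"
  shows False
proof -
  define t1 where "t1 = t0 + (\<bar>B\<bar> + \<bar>f t0\<bar> + 1) / e"
  have t1: "t0 \<le> t1"
    using \<open>e > 0\<close> by (auto simp: t1_def)
  have "f t0 - e * t0 \<le> f t1 - e * t1"
  proof (rule DERIV_nonneg_imp_nondecreasing[OF t1])
    fix t assume t: "t0 \<le> t"
    have "((\<lambda>t. f t - e * t) has_real_derivative f' t - e) (at t)"
      by (rule derivative_eq_intros f[OF t] refl)+ simp
    then show "\<exists>y. ((\<lambda>t. f t - e * t) has_real_derivative y) (at t) \<and> 0 \<le> y"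
      using le[OF t] by force
  qed
  moreover have "e * t1 - e * t0 = \<bar>B\<bar> + \<bar>f t0\<bar> + 1"
    using \<open>e > 0\<close> by (simp add: t1_def field_simps)
  ultimately show False
    using B[OF t1] by linarith
qed

section \<open>Global solutions of Riccati equations\<close>

abbreviation (input) riccati :: "(real \<Rightarrow> real) \<Rightarrow> real \<Rightarrow> real \<Rightarrow> real" where
  "riccati q \<equiv> \<lambda>t x. - x\<^sup>2 + q t"

lemma riccati_deriv:
  "global_solution (riccati q) x \<Longrightarrow> (x has_real_derivative - (x t)\<^sup>2 + q t) (at t)"
  by (simp add: global_solution_def)

lemma global_solution_continuous:
  "global_solution h x \<Longrightarrow> continuous_on A x"
  by (meson DERIV_isCont continuous_at_imp_continuous_on global_solution_def)

lemma has_real_derivative_reflect: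
  "(f has_real_derivative D) (at (- t)) \<Longrightarrow> ((\<lambda>t. f (- t)) has_real_derivative - D) (at t)"
  for f :: "real \<Rightarrow> real"
  using DERIV_mirror[of f D t] by simp

text \<open>The change of variables \<open>(t, x) \<mapsto> (-t, -x)\<close> maps the family of Riccati equations to itself.
  It exchanges the two ends of the time axis, attraction and repulsion, upper and lower
  solutions, so that every one-sided statement below has to be proved on one side only.\<close>

lemma riccati_reflect:
  assumes "global_solution (riccati q) x"
  shows "global_solution (riccati (\<lambda>t. q (- t))) (\<lambda>t. - x (- t))"
  unfolding global_solution_def
proof
  fix t
  show "((\<lambda>t. - x (- t)) has_real_derivative - (- x (- t))\<^sup>2 + q (- t)) (at t)"
    using DERIV_minus[OF has_real_derivative_reflect[OF riccati_deriv[OF assms, of "- t"]]] by simp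
qed

lemma riccati_difference_deriv:
  assumes "global_solution (riccati q) x" "global_solution (riccati q) y"
  shows "((\<lambda>t. y t - x t) has_real_derivative - (x t + y t) * (y t - x t)) (at t)"
  by (rule derivative_eq_intros riccati_deriv assms refl)+ (simp add: power2_eq_square algebra_simps)

lemma riccati_order_preserved:
  assumes x: "global_solution (riccati q) x" and y: "global_solution (riccati q) y"
    and less: "x t0 < y t0"
  shows "x t < y t"
proof (cases "t0 \<le> t")
  case True
  have "continuous_on UNIV (\<lambda>t. - (x t + y t))"
    by (intro continuous_intros global_solution_continuous[OF x] global_solution_continuous[OF y])
  from linear_lower_bound[OF riccati_difference_deriv[OF x y] order.refl this True]
  obtain C where "C > 0" "C * (y t0 - x t0) \<le> y t - x t"
    by blast
  then show ?thesis
    using less mult_pos_pos[of C "y t0 - x t0"] by linarith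
next
  case False
  then have "t \<le> t0" by simp
  have "continuous_on UNIV (\<lambda>t. - (y t + x t))"
    by (intro continuous_intros global_solution_continuous[OF x] global_solution_continuous[OF y])
  from linear_lower_bound[OF riccati_difference_deriv[OF y x] order.refl this \<open>t \<le> t0\<close>]
  obtain C where C: "C > 0" "C * (x t - y t) \<le> x t0 - y t0"
    by blast
  show ?thesis
  proof (rule ccontr)
    assume "\<not> x t < y t"
    then show False
      using less C mult_nonneg_nonneg[of C "x t - y t"] by linarith
  qed
qed

text \<open>Below \<open>-M\<close> the derivative is at most \<open>M\<^sup>2 - x\<^sup>2\<close>, so the gap \<open>z = -M - x\<close> satisfies
  \<open>z' \<ge> z\<^sup>2\<close> and \<open>-1/z\<close> would have to become positive in finite time.\<close>

lemma riccati_global_lower_bound: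
  assumes x: "global_solution (riccati q) x" and q: "\<And>t. q t \<le> M\<^sup>2" and "M \<ge> 0"
  shows "- M \<le> x t0"
proof (rule ccontr)
  assume "\<not> - M \<le> x t0"
  define z where "z = (\<lambda>t. - M - x t)"
  have z0: "z t0 > 0"
    using \<open>\<not> - M \<le> x t0\<close> by (simp add: z_def)
  have dz: "(z has_real_derivative (x t)\<^sup>2 - q t) (at t)" for t
    unfolding z_def by (rule derivative_eq_intros riccati_deriv[OF x] refl)+ simp
  have dz_ge: "(z t + 2 * M) * z t \<le> (x t)\<^sup>2 - q t" for t
    using q[of t] by (simp add: z_def power2_eq_square algebra_simps)
  have cont: "continuous_on UNIV (\<lambda>t. z t + 2 * M)"
    unfolding z_def by (intro continuous_intros global_solution_continuous[OF x])
  have zpos: "z t > 0" if t: "t0 \<le> t" for t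
  proof -
    obtain C where "C > 0" "C * z t0 \<le> z t"
      using linear_lower_bound[OF dz dz_ge cont t] by blast
    then show ?thesis
      using z0 mult_pos_pos[of C "z t0"] by linarith
  qed
  show False
  proof (rule derivative_ge_pos_unbounded)
    fix t assume t: "t0 \<le> t"
    show "((\<lambda>t. - (1 / z t)) has_real_derivative ((x t)\<^sup>2 - q t) / (z t)\<^sup>2) (at t)"
      by (rule DERIV_cong[OF DERIV_minus[OF DERIV_divide[OF DERIV_const dz]]])
        (use zpos[OF t] in \<open>simp_all add: field_simps power2_eq_square\<close>)
    have "(z t)\<^sup>2 \<le> (z t + 2 * M) * z t"
      using zpos[OF t] \<open>M \<ge> 0\<close> by (simp add: power2_eq_square algebra_simps)
    then have "(z t)\<^sup>2 \<le> (x t)\<^sup>2 - q t"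
      using dz_ge[of t] by linarith
    then show "1 \<le> ((x t)\<^sup>2 - q t) / (z t)\<^sup>2"
      using zpos[OF t] by simp
    show "- (1 / z t) \<le> 0"
      using zpos[OF t] by simp
  qed simp
qed

lemma riccati_global_bounded:
  assumes x: "global_solution (riccati q) x" and "bounded (range q)"
  obtains M where "M > 0" "\<And>t. \<bar>x t\<bar> \<le> M"
proof -
  obtain B where B: "B > 0" "\<And>t. \<bar>q t\<bar> \<le> B"
    using \<open>bounded (range q)\<close> by (auto simp: bounded_pos)
  have q: "q t \<le> (sqrt B)\<^sup>2" for t
    using B(1) B(2)[of t] by simp
  have "- sqrt B \<le> x t" for t
    using riccati_global_lower_bound[OF x q, of t] B by simp
  moreover have "- sqrt B \<le> - x t" for t
    using riccati_global_lower_bound[OF riccati_reflect[OF x] q, of "- t"] B by simp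
  ultimately have "\<bar>x t\<bar> \<le> sqrt B" for t
    by (simp add: abs_le_iff minus_le_iff)
  then show ?thesis
    using that[of "sqrt B"] B by simp
qed

text \<open>If \<open>y\<close> is a solution, then \<open>u = 1/(y - x)\<close> turns solutions \<open>x < y\<close> into positive solutions
  of the linear equation \<open>u' = 2 y u - 1\<close>, whose general solution is \<open>u = E (C - F)\<close> with
  \<open>E' = 2 y E\<close> and \<open>F' = 1/E\<close>.  Positivity for all times means that \<open>C\<close> is an upper bound of the
  increasing function \<open>F\<close>.  Hence one global solution below \<open>y\<close> makes \<open>F\<close> bounded, and \<open>C = sup F\<close>
  gives the lowest global solution.  The factor \<open>H = C - F\<close> records that it is the lowest one: it is a
  positive solution of \<open>H' = - (y - x) H\<close> with infimum zero.\<close>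

lemma riccati_lowest_solution:
  assumes x1: "global_solution (riccati q) x1" and y: "global_solution (riccati q) y"
    and less: "\<And>t. x1 t < y t"
  obtains x H where "global_solution (riccati q) x" "\<And>t. x t < y t" "\<And>t. H t > 0"
    "\<And>t. (H has_real_derivative - (y t - x t) * H t) (at t)"
    "\<And>e. e > 0 \<Longrightarrow> \<exists>t. H t < e"
proof -
  have "continuous_on UNIV (\<lambda>t. 2 * y t)"
    by (intro continuous_intros global_solution_continuous[OF y])
  then obtain A where A: "\<And>t. (A has_real_derivative 2 * y t) (at t)"
    using antiderivative_exists by blast
  define E where "E = (\<lambda>t. exp (A t))"
  have Epos: "E t > 0" for t by (simp add: E_def)
  have dE: "(E has_real_derivative 2 * y t * E t) (at t)" for t
    unfolding E_def by (auto intro!: derivative_eq_intros A)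
  have cE: "continuous_on UNIV (\<lambda>t. 1 / E t)"
    using Epos by (intro continuous_intros DERIV_continuous_on[OF has_field_derivative_at_within[OF dE]])
      (metis less_irrefl)
  obtain F where F: "\<And>t. (F has_real_derivative 1 / E t) (at t)"
    using antiderivative_exists[OF cE] by blast
  have Fless: "F s < F t" if "s < t" for s t
    using DERIV_pos_imp_increasing[OF that, of F] F Epos by (metis divide_pos_pos zero_less_one)
  define w where "w = (\<lambda>t. y t - x1 t)"
  have wpos: "w t > 0" for t
    using less by (simp add: w_def)
  have dw: "(w has_real_derivative - (x1 t + y t) * w t) (at t)" for t
    unfolding w_def by (rule riccati_difference_deriv[OF x1 y])
  \<comment> \<open>\<open>v\<close> is the constant \<open>C\<close> that belongs to the given solution \<open>x1\<close>.\<close>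
  define v where "v = (\<lambda>t. 1 / (w t * E t) + F t)"
  have "(v has_real_derivative 0) (at t)" for t
  proof -
    have ne: "w t * E t \<noteq> 0"
      using wpos[of t] Epos[of t] by auto
    have "((\<lambda>t. w t * E t) has_real_derivative w t * (w t * E t)) (at t)"
      by (rule derivative_eq_intros dE dw refl)+ (simp add: w_def algebra_simps)
    from DERIV_add[OF DERIV_divide[OF DERIV_const this ne, of 1] F]
    show ?thesis
      using ne by (simp add: v_def)
  qed
  then have v: "v t = v 0" for t
    by (rule DERIV_isconst_all[rule_format])
  have Fv: "F t \<le> v 0" for t
    using v[of t] divide_pos_pos[OF zero_less_one mult_pos_pos[OF wpos[of t] Epos[of t]]]
    unfolding v_def by linarith
  then have bdd: "bdd_above (range F)"
    by (auto intro!: bdd_aboveI)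
  define C where "C = Sup (range F)"
  define H where "H = (\<lambda>t. C - F t)"
  have Hpos: "H t > 0" for t
  proof -
    have "F t < F (t + 1)" "F (t + 1) \<le> C"
      using Fless cSup_upper[OF _ bdd] by (auto simp: C_def)
    then show ?thesis by (simp add: H_def)
  qed
  define x where "x = (\<lambda>t. y t - 1 / (E t * H t))"
  have dH: "(H has_real_derivative - (1 / E t)) (at t)" for t
    unfolding H_def by (auto intro!: derivative_eq_intros F)
  show ?thesis
  proof
    show "global_solution (riccati q) x"
      unfolding global_solution_def
    proof
      fix t
      have ne: "E t * H t \<noteq> 0"
        using Epos[of t] Hpos[of t] by simp
      have "((\<lambda>t. E t * H t) has_real_derivative 2 * y t * (E t * H t) - 1) (at t)"
        by (rule derivative_eq_intros dE dH refl)+ (use Epos[of t] in \<open>simp add: algebra_simps\<close>)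
      note d = DERIV_diff[OF riccati_deriv[OF y] DERIV_divide[OF DERIV_const this ne]]
      show "(x has_real_derivative - (x t)\<^sup>2 + q t) (at t)"
        unfolding x_def
        by (rule DERIV_cong[OF d]) (use ne in \<open>simp add: field_simps power2_eq_square\<close>)
    qed
    show "x t < y t" "H t > 0" for t
      using Epos[of t] Hpos[of t] by (simp_all add: x_def)
    show "(H has_real_derivative - (y t - x t) * H t) (at t)" for t
      using dH[of t] Hpos[of t] by (simp add: x_def)
    show "\<exists>t. H t < e" if "e > 0" for e
    proof -
      have "C - e < Sup (range F)"
        using that by (simp add: C_def)
      then obtain t where "C - e < F t"
        by (subst (asm) less_cSup_iff) (use bdd in auto)
      then show ?thesis
        by (auto simp: H_def intro!: exI[of _ t])
    qed
  qed
qed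

section \<open>Hyperbolicity and uniform separation\<close>

lemma variational_integral:
  assumes "\<And>t. deriv (h t) (b t) = m t" "continuous_on UNIV m"
    and A: "\<And>t. (A has_real_derivative m t) (at t)"
  shows "(LBINT l=s..t. deriv (h l) (b l)) = A t - A s"
  unfolding assms(1)
  by (rule interval_integral_FTC_finite)
    (use assms(2) A in \<open>auto intro: continuous_on_subset has_vector_derivative_at_within
      simp: has_real_derivative_iff_has_vector_derivative\<close>)

lemma riccati_variational_integral:
  assumes b: "global_solution (riccati q) b"
    and A: "\<And>t. (A has_real_derivative - 2 * b t) (at t)"
  shows "(LBINT l=s..t. deriv (riccati q l) (b l)) = A t - A s"
proof (rule variational_integral[OF _ _ A])
  show "deriv (riccati q t) (b t) = - 2 * b t" for t
    by (rule DERIV_imp_deriv) (auto intro!: derivative_eq_intros)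
  show "continuous_on UNIV (\<lambda>t. - 2 * b t)"
    by (intro continuous_intros global_solution_continuous[OF b])
qed

lemma no_bounded_contraction:
  fixes d d' m A :: "real \<Rightarrow> real"
  assumes d: "\<And>t. (d has_real_derivative d' t) (at t)" and le: "\<And>t. d' t \<le> m t * d t"
    and A: "\<And>t. (A has_real_derivative m t) (at t)"
    and decay: "\<And>s t. s \<le> t \<Longrightarrow> exp (A t - A s) \<le> k * exp (- \<beta> * (t - s))"
    and "\<beta> > 0" and pos: "\<And>t. d t > 0" and D: "\<And>t. d t \<le> D"
  shows False
proof -
  have "d 0 \<le> D * (k * exp (\<beta> * s))" if "s \<le> 0" for s
  proof -
    have "d 0 * exp (- A 0) \<le> d s * exp (- A s)"
    proof (rule DERIV_nonpos_imp_nonincreasing[OF that])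
      fix t
      have "((\<lambda>t. d t * exp (- A t)) has_real_derivative (d' t - m t * d t) * exp (- A t)) (at t)"
        by (rule derivative_eq_intros d A refl)+ (simp add: algebra_simps)
      moreover have "(d' t - m t * d t) * exp (- A t) \<le> 0"
        using le[of t] by (simp add: mult_le_0_iff)
      ultimately show "\<exists>y. ((\<lambda>t. d t * exp (- A t)) has_real_derivative y) (at t) \<and> y \<le> 0"
        by blast
    qed
    then have "d 0 \<le> d s * exp (A 0 - A s)"
      by (simp add: exp_diff exp_minus field_simps)
    also have "\<dots> \<le> D * (k * exp (\<beta> * s))"
      using decay[OF that] pos[of s] D[of s] by (intro mult_mono) auto
    finally show ?thesis .
  qed
  then have "\<forall>\<^sub>F s in at_bot. d 0 \<le> D * (k * exp (\<beta> * s))"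
    by (auto simp: eventually_at_bot_linorder)
  moreover have "((\<lambda>s. D * (k * exp (\<beta> * s))) \<longlongrightarrow> 0) at_bot"
    using \<open>\<beta> > 0\<close> by real_asymp
  ultimately have "d 0 \<le> 0"
    by (intro tendsto_lowerbound) auto
  then show False
    using pos[of 0] by simp
qed

text \<open>The reciprocal \<open>u = 1/d\<close> satisfies \<open>u' = - m u - 1\<close>.  By variation of constants, \<open>u(s)\<close> is the
  damped value of \<open>u(0)\<close> plus an integral of the damping factor, which is at most \<open>k/\<beta>\<close>.  The proof
  replaces that integral by the monotonicity of a suitable expression in \<open>t\<close>.\<close>

lemma separation_in_the_past:
  fixes d m A :: "real \<Rightarrow> real"
  assumes d: "\<And>t. (d has_real_derivative (m t + d t) * d t) (at t)"
    and A: "\<And>t. (A has_real_derivative m t) (at t)"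
    and decay: "\<And>s t. s \<le> t \<Longrightarrow> exp (A t - A s) \<le> k * exp (- \<beta> * (t - s))"
    and "\<beta> > 0" and pos: "\<And>t. d t > 0"
  obtains \<delta> where "\<delta> > 0" "\<And>t. t \<le> 0 \<Longrightarrow> \<delta> \<le> d t"
proof -
  have k: "k \<ge> 1"
    using decay[of 0 0] by simp
  define B where "B = k / \<beta> + k / d 0"
  have B: "B > 0"
    using k \<open>\<beta> > 0\<close> pos[of 0] by (auto simp: B_def intro!: add_pos_pos)
  have "1 / d s \<le> B" if "s \<le> 0" for s
  proof -
    let ?G = "\<lambda>t. 1 / d t * exp (A t - A s) - k / \<beta> * exp (- \<beta> * (t - s))"
    have "?G s \<le> ?G 0"
    proof (rule DERIV_nonneg_imp_nondecreasing[OF that])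
      fix t assume t: "s \<le> t"
      have ne: "d t \<noteq> 0"
        using pos[of t] by simp
      have "(?G has_real_derivative - exp (A t - A s) + k * exp (- \<beta> * (t - s))) (at t)"
        by (rule derivative_eq_intros d A ne refl)+
          (use ne \<open>\<beta> > 0\<close> in \<open>simp add: field_simps\<close>)
      then show "\<exists>y. (?G has_real_derivative y) (at t) \<and> 0 \<le> y"
        using decay[OF t] by force
    qed
    then have "1 / d s \<le> k / \<beta> + (1 / d 0 * exp (A 0 - A s) - k / \<beta> * exp (\<beta> * s))"
      by simp
    also have "\<dots> \<le> k / \<beta> + 1 / d 0 * exp (A 0 - A s)"
      using k \<open>\<beta> > 0\<close> by simp
    also have "exp (A 0 - A s) \<le> k"
    proof -
      have "exp (A 0 - A s) \<le> k * exp (\<beta> * s)"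
        using decay[OF that] by simp
      also have "\<dots> \<le> k * 1"
        using k \<open>\<beta> > 0\<close> that by (intro mult_left_mono) (auto simp: mult_le_0_iff)
      finally show ?thesis by simp
    qed
    then have "1 / d 0 * exp (A 0 - A s) \<le> k / d 0"
      using pos[of 0] by (simp add: divide_right_mono)
    finally show ?thesis
      by (simp add: B_def)
  qed
  then have "1 / B \<le> d s" if "s \<le> 0" for s
    using that pos[of s] B by (fastforce simp: field_simps)
  then show ?thesis
    using that[of "1 / B"] B by simp
qed

text \<open>The upper of two hyperbolic solutions cannot be repulsive and the lower one cannot be
  attractive: their distance would then decay exponentially in one direction of time, which a positive
  function bounded on the whole line cannot do.  So the upper one is attractive, which bounds the distance from below in the past, and the lower one is repulsive,
  which does the same for the future.\<close>

lemma hyperbolic_solutions_separated: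
  assumes hx: "hyperbolic_solution (riccati p) x" and hy: "hyperbolic_solution (riccati p) y"
    and less: "\<And>t. x t < y t" and p: "bounded (range p)"
  obtains \<delta> where "\<delta> > 0" "\<And>t. \<delta> \<le> y t - x t"
proof -
  have x: "global_solution (riccati p) x" and y: "global_solution (riccati p) y"
    using hx hy by (auto simp: hyperbolic_solution_def)
  have "continuous_on UNIV (\<lambda>t. - 2 * x t)" "continuous_on UNIV (\<lambda>t. - 2 * y t)"
    by (intro continuous_intros global_solution_continuous[OF x] global_solution_continuous[OF y])+
  then obtain A B where A: "\<And>t. (A has_real_derivative - 2 * x t) (at t)"
    and B: "\<And>t. (B has_real_derivative - 2 * y t) (at t)"
    using antiderivative_exists by metis
  define d where "d = (\<lambda>t. y t - x t)"
  have dpos: "d t > 0" for t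
    using less by (simp add: d_def)
  obtain M N where "\<And>t. \<bar>x t\<bar> \<le> M" "\<And>t. \<bar>y t\<bar> \<le> N"
    using riccati_global_bounded[OF x p] riccati_global_bounded[OF y p] by metis
  then have dD: "d t \<le> M + N" for t
    by (smt (verit) d_def)
  have dd: "(d has_real_derivative - (x t + y t) * d t) (at t)" for t
    unfolding d_def by (rule riccati_difference_deriv[OF x y])
  have refl: "((\<lambda>t. d (- t)) has_real_derivative (x (- t) + y (- t)) * d (- t)) (at t)"
    "((\<lambda>t. A (- t)) has_real_derivative 2 * x (- t)) (at t)"
    "((\<lambda>t. B (- t)) has_real_derivative 2 * y (- t)) (at t)" for t
    using has_real_derivative_reflect[OF dd[of "- t"]] has_real_derivative_reflect[OF A[of "- t"]]
      has_real_derivative_reflect[OF B[of "- t"]] by (simp_all add: algebra_simps)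
  have nonatt: False if att: "attractive_along (riccati p) x k \<beta>" "\<beta> > 0" for k \<beta>
  proof (rule no_bounded_contraction[OF dd _ A _ \<open>\<beta> > 0\<close> dpos dD])
    show "- (x t + y t) * d t \<le> - 2 * x t * d t" for t
      using dpos[of t] by (intro mult_right_mono) (auto simp: d_def)
    show "exp (A t - A s) \<le> k * exp (- \<beta> * (t - s))" if "s \<le> t" for s t
      using att that unfolding attractive_along_def riccati_variational_integral[OF x A] by simp
  qed
  have nonrep: False if rep: "repulsive_along (riccati p) y k \<beta>" "\<beta> > 0" for k \<beta>
  proof (rule no_bounded_contraction[OF refl(1) _ refl(3) _ \<open>\<beta> > 0\<close> dpos dD])
    show "(x (- t) + y (- t)) * d (- t) \<le> 2 * y (- t) * d (- t)" for t
      using dpos[of "- t"] by (intro mult_right_mono) (auto simp: d_def)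
    show "exp (B (- t) - B (- s)) \<le> k * exp (- \<beta> * (t - s))" if "s \<le> t" for s t
      using rep that unfolding repulsive_along_def riccati_variational_integral[OF y B]
      by (elim conjE allE[of _ "- s"] allE[of _ "- t"]) (simp add: algebra_simps)
  qed
  obtain k \<beta> where "\<beta> > 0" and att: "attractive_along (riccati p) y k \<beta>"
    using hy nonrep by (auto simp: hyperbolic_solution_def)
  obtain k' \<beta>' where "\<beta>' > 0" and rep: "repulsive_along (riccati p) x k' \<beta>'"
    using hx nonatt by (auto simp: hyperbolic_solution_def)
  obtain \<delta> where \<delta>: "\<delta> > 0" "\<And>t. t \<le> 0 \<Longrightarrow> \<delta> \<le> d t"
  proof (rule separation_in_the_past[OF _ B _ \<open>\<beta> > 0\<close> dpos])
    show "(d has_real_derivative (- 2 * y t + d t) * d t) (at t)" for t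
      using dd[of t] by (simp add: d_def algebra_simps)
    show "exp (B t - B s) \<le> k * exp (- \<beta> * (t - s))" if "s \<le> t" for s t
      using att that unfolding attractive_along_def riccati_variational_integral[OF y B] by simp
  qed blast
  obtain \<delta>' where \<delta>': "\<delta>' > 0" "\<And>t. t \<le> 0 \<Longrightarrow> \<delta>' \<le> d (- t)"
  proof (rule separation_in_the_past[OF _ refl(2) _ \<open>\<beta>' > 0\<close> dpos])
    show "((\<lambda>t. d (- t)) has_real_derivative (2 * x (- t) + d (- t)) * d (- t)) (at t)" for t
      using refl(1)[of t] by (simp add: d_def algebra_simps)
    show "exp (A (- t) - A (- s)) \<le> k' * exp (- \<beta>' * (t - s))" if "s \<le> t" for s t
      using rep that unfolding repulsive_along_def riccati_variational_integral[OF x A]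
      by (elim conjE allE[of _ "- s"] allE[of _ "- t"]) (simp add: algebra_simps)
  qed blast
  have "min \<delta> \<delta>' \<le> y t - x t" for t
    using \<delta>(2)[of t] \<delta>'(2)[of "- t"] by (cases "t \<le> 0") (auto simp: d_def min_def)
  then show ?thesis
    using that[of "min \<delta> \<delta>'"] \<delta>(1) \<delta>'(1) by simp
qed

text \<open>Conversely, the distance \<open>w = x2 - x1\<close> satisfies \<open>- 2 x2 = (ln w)' - w\<close> and
  \<open>- 2 x1 = (ln w)' + w\<close>.  When \<open>w\<close> lies between positive constants, the integrals of \<open>- 2 x2\<close> and
  \<open>- 2 x1\<close> are therefore linear in time up to a bounded error.  The field \<open>h\<close> and its solutions
  \<open>b1\<close>, \<open>b2\<close> are arbitrary here so that the lemma also applies after a translation of the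
  unknown.\<close>

lemma separated_solutions_hyperbolic:
  assumes x1: "global_solution (riccati q) x1" and x2: "global_solution (riccati q) x2"
    and \<epsilon>: "\<epsilon> > 0" "\<And>t. \<epsilon> \<le> x2 t - x1 t" and D: "\<And>t. x2 t - x1 t \<le> D"
    and b: "global_solution h b1" "global_solution h b2"
    and deriv: "\<And>t. deriv (h t) (b1 t) = - 2 * x1 t" "\<And>t. deriv (h t) (b2 t) = - 2 * x2 t"
  shows "hyperbolic_solution h b1 \<and> hyperbolic_solution h b2"
proof -
  have cont: "continuous_on UNIV (\<lambda>t. - 2 * x1 t)" "continuous_on UNIV (\<lambda>t. - 2 * x2 t)"
    by (intro continuous_intros global_solution_continuous[OF x1] global_solution_continuous[OF x2])+
  then obtain A1 A2 where A1: "\<And>t. (A1 has_real_derivative - 2 * x1 t) (at t)"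
    and A2: "\<And>t. (A2 has_real_derivative - 2 * x2 t) (at t)"
    using antiderivative_exists by metis
  note int1 = variational_integral[OF deriv(1) cont(1) A1]
  note int2 = variational_integral[OF deriv(2) cont(2) A2]
  define w where "w = (\<lambda>t. x2 t - x1 t)"
  have w: "\<epsilon> \<le> w t" "w t \<le> D" "0 < w t" for t
    using \<epsilon>(1) \<epsilon>(2)[of t] D[of t] by (auto simp: w_def)
  have dlnw: "((\<lambda>t. ln (w t)) has_real_derivative - (x1 t + x2 t)) (at t)" for t
  proof -
    have "(w has_real_derivative - (x1 t + x2 t) * w t) (at t)"
      unfolding w_def by (rule riccati_difference_deriv[OF x1 x2])
    from DERIV_chain2[OF DERIV_ln_divide[OF w(3)] this] show ?thesis
      using w(3)[of t] by simp
  qed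
  have k: "D / \<epsilon> \<ge> 1"
    using w(1,2)[of 0] \<epsilon>(1) by simp
  have ratio: "exp (ln (w t) - ln (w s) + z) \<le> D / \<epsilon> * exp z" for s t z
  proof -
    have "exp (ln (w t) - ln (w s) + z) = w t / w s * exp z"
      using w(3) by (simp add: exp_add exp_diff)
    also have "\<dots> \<le> D / \<epsilon> * exp z"
      using w[of t] w[of s] \<epsilon>(1) by (intro mult_right_mono frac_le) auto
    finally show ?thesis .
  qed
  have "attractive_along h b2 (D / \<epsilon>) \<epsilon>"
    unfolding attractive_along_def int2
  proof (intro allI impI)
    fix s t :: real assume "s \<le> t"
    have "A2 t - ln (w t) + \<epsilon> * t \<le> A2 s - ln (w s) + \<epsilon> * s"
    proof (rule DERIV_nonpos_imp_nonincreasing[OF \<open>s \<le> t\<close>])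
      fix l
      have "((\<lambda>l. A2 l - ln (w l) + \<epsilon> * l) has_real_derivative \<epsilon> - w l) (at l)"
        by (rule derivative_eq_intros A2 dlnw refl)+ (simp add: w_def)
      then show "\<exists>y. ((\<lambda>l. A2 l - ln (w l) + \<epsilon> * l) has_real_derivative y) (at l) \<and> y \<le> 0"
        using w(1)[of l] by force
    qed
    then have "exp (A2 t - A2 s) \<le> exp (ln (w t) - ln (w s) + (- \<epsilon> * (t - s)))"
      by (simp add: algebra_simps)
    also note ratio
    finally show "exp (A2 t - A2 s) \<le> D / \<epsilon> * exp (- \<epsilon> * (t - s))" .
  qed
  moreover have "repulsive_along h b1 (D / \<epsilon>) \<epsilon>"
    unfolding repulsive_along_def int1
  proof (intro allI impI)
    fix s t :: real assume "t \<le> s"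
    have "A1 t - ln (w t) - \<epsilon> * t \<le> A1 s - ln (w s) - \<epsilon> * s"
    proof (rule DERIV_nonneg_imp_nondecreasing[OF \<open>t \<le> s\<close>])
      fix l
      have "((\<lambda>l. A1 l - ln (w l) - \<epsilon> * l) has_real_derivative w l - \<epsilon>) (at l)"
        by (rule derivative_eq_intros A1 dlnw refl)+ (simp add: w_def)
      then show "\<exists>y. ((\<lambda>l. A1 l - ln (w l) - \<epsilon> * l) has_real_derivative y) (at l) \<and> 0 \<le> y"
        using w(1)[of l] by force
    qed
    then have "exp (A1 t - A1 s) \<le> exp (ln (w t) - ln (w s) + \<epsilon> * (t - s))"
      by (simp add: algebra_simps)
    also note ratio
    finally show "exp (A1 t - A1 s) \<le> D / \<epsilon> * exp (\<epsilon> * (t - s))" .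
  qed
  ultimately show ?thesis
    using b k \<epsilon>(1) unfolding hyperbolic_solution_def by blast
qed

section \<open>Decaying perturbations of an equation with a separated pair\<close>

locale perturbed_riccati =
  fixes p q r a :: "real \<Rightarrow> real" and \<delta> :: real
  assumes r: "global_solution (riccati p) r" and a: "global_solution (riccati p) a"
    and \<delta>: "\<delta> > 0" "\<And>t. \<delta> \<le> a t - r t"
    and p_bounded: "bounded (range p)" and q_bounded: "bounded (range q)"
    and q_le_p: "\<And>t. q t \<le> p t"
    and decay: "((\<lambda>t. p t - q t) \<longlongrightarrow> 0) at_infinity"
begin

text \<open>In the moving frame spanned by \<open>r\<close> (position 0) and \<open>a\<close> (position 1), the perturbed
  equation becomes the logistic equation with a small loss term.\<close>

definition pos :: "(real \<Rightarrow> real) \<Rightarrow> real \<Rightarrow> real" where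
  "pos x t = (x t - r t) / (a t - r t)"

abbreviation rate :: "(real \<Rightarrow> real) \<Rightarrow> real \<Rightarrow> real" where
  "rate x t \<equiv> (a t - r t) * (pos x t * (1 - pos x t)) - (p t - q t) / (a t - r t)"

lemma gap_pos: "a t - r t > 0"
  using \<delta>(1) \<delta>(2)[of t] by linarith

lemma gap_bounded:
  obtains D where "D > 0" "\<And>t. a t - r t \<le> D"
proof -
  obtain M N where "M > 0" "\<And>t. \<bar>r t\<bar> \<le> M" "N > 0" "\<And>t. \<bar>a t\<bar> \<le> N"
    using riccati_global_bounded[OF r p_bounded] riccati_global_bounded[OF a p_bounded] by metis
  then show ?thesis
    using that[of "M + N"] by (smt (verit))
qed

lemma pos_mult_gap: "x t = r t + pos x t * (a t - r t)"
  using gap_pos[of t] by (simp add: pos_def)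

lemma gap_mult_pos_difference: "(a t - r t) * (pos y t - pos x t) = y t - x t"
  using pos_mult_gap[of x t] pos_mult_gap[of y t] by (simp add: algebra_simps)

lemma pos_less_iff: "pos x t < pos y t \<longleftrightarrow> x t < y t"
  using gap_pos[of t] by (simp add: pos_def divide_less_cancel)

lemma pos_deriv:
  assumes x: "global_solution (riccati q) x"
  shows "(pos x has_real_derivative rate x t) (at t)"
proof -
  have "((\<lambda>t. (x t - r t) / (a t - r t)) has_real_derivative
      ((- (x t)\<^sup>2 + q t - (- (r t)\<^sup>2 + p t)) * (a t - r t) -
       (x t - r t) * (- (r t + a t) * (a t - r t))) / ((a t - r t) * (a t - r t))) (at t)"
    using gap_pos[of t]
    by (intro DERIV_divide DERIV_diff riccati_deriv x r riccati_difference_deriv[OF r a]) simp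
  also have "((- (x t)\<^sup>2 + q t - (- (r t)\<^sup>2 + p t)) * (a t - r t) -
       (x t - r t) * (- (r t + a t) * (a t - r t))) / ((a t - r t) * (a t - r t)) = rate x t"
    (is "?L = ?R")
  proof -
    have "(- (x t)\<^sup>2 + q t - (- (r t)\<^sup>2 + p t)) * (a t - r t) -
        (x t - r t) * (- (r t + a t) * (a t - r t)) =
        (- (x t)\<^sup>2 + q t - (- (r t)\<^sup>2 + p t) + (x t - r t) * (r t + a t)) * (a t - r t)"
      by (simp add: algebra_simps)
    then have "?L = (- (x t)\<^sup>2 + q t - (- (r t)\<^sup>2 + p t) + (x t - r t) * (r t + a t)) / (a t - r t)"
      using gap_pos[of t] by simp
    also have "- (x t)\<^sup>2 + q t - (- (r t)\<^sup>2 + p t) + (x t - r t) * (r t + a t) =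
        (a t - r t)\<^sup>2 * (pos x t * (1 - pos x t)) - (p t - q t)"
      by (subst (1 2) pos_mult_gap[of x t]) (simp add: power2_eq_square algebra_simps)
    also have "\<dots> / (a t - r t) = ?R"
      using gap_pos[of t] by (simp add: diff_divide_distrib power2_eq_square)
    finally show ?thesis .
  qed
  finally show ?thesis
    unfolding pos_def[abs_def] .
qed

lemma pos_continuous:
  assumes "global_solution (riccati q) x"
  shows "continuous_on A (pos x)"
  by (rule DERIV_continuous_on[OF has_field_derivative_at_within[OF pos_deriv[OF assms]]])

lemma gap_continuous: "continuous_on A (\<lambda>t. a t - r t)"
  by (intro continuous_intros global_solution_continuous[OF a] global_solution_continuous[OF r])

lemma pos_bounded:
  assumes x: "global_solution (riccati q) x"
  obtains B where "\<And>t. \<bar>pos x t\<bar> \<le> B"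
proof -
  obtain M N where M: "M > 0" "\<And>t. \<bar>x t\<bar> \<le> M" and N: "N > 0" "\<And>t. \<bar>r t\<bar> \<le> N"
    using riccati_global_bounded[OF x q_bounded] riccati_global_bounded[OF r p_bounded] by metis
  have "\<bar>pos x t\<bar> \<le> (M + N) / \<delta>" for t
  proof -
    have "\<bar>pos x t\<bar> = \<bar>x t - r t\<bar> / (a t - r t)"
      using gap_pos[of t] by (simp add: pos_def)
    also have "\<dots> \<le> (M + N) / \<delta>"
      using M(2)[of t] N(2)[of t] \<delta>(1) \<delta>(2)[of t] by (intro frac_le) auto
    finally show ?thesis .
  qed
  then show ?thesis using that by blast
qed

lemma reflected:
  "perturbed_riccati (\<lambda>t. p (- t)) (\<lambda>t. q (- t)) (\<lambda>t. - a (- t)) (\<lambda>t. - r (- t)) \<delta>"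
proof
  show "global_solution (riccati (\<lambda>t. p (- t))) (\<lambda>t. - a (- t))"
    "global_solution (riccati (\<lambda>t. p (- t))) (\<lambda>t. - r (- t))"
    by (rule riccati_reflect a r)+
  show "\<delta> > 0" "\<delta> \<le> - r (- t) - - a (- t)" "q (- t) \<le> p (- t)" for t
    using \<delta> q_le_p by (auto simp: algebra_simps)
  show "bounded (range (\<lambda>t. p (- t)))" "bounded (range (\<lambda>t. q (- t)))"
    by (rule bounded_subset[OF p_bounded] bounded_subset[OF q_bounded]; auto)+
  show "((\<lambda>t. p (- t) - q (- t)) \<longlongrightarrow> 0) at_infinity"
  proof (rule filterlim_compose[OF decay])
    show "filterlim (\<lambda>t::real. - t) at_infinity at_infinity"
      by (rule filterlim_norm_at_top_imp_at_infinity) (simp only: norm_minus_cancel filterlim_norm_at_top)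
  qed
qed

lemma reflected_pos:
  "perturbed_riccati.pos (\<lambda>t. - a (- t)) (\<lambda>t. - r (- t)) (\<lambda>t. - x (- t)) t = 1 - pos x (- t)"
  using gap_pos[of "- t"] unfolding perturbed_riccati.pos_def[OF reflected] pos_def
  by (simp add: field_simps)

text \<open>Above position 1 both the logistic term and the perturbation push down, so that a solution
  that is there once has always been there, and has come down from arbitrarily high.\<close>

lemma pos_le_1:
  assumes x: "global_solution (riccati q) x"
  shows "pos x t0 \<le> 1"
proof (rule ccontr)
  assume "\<not> pos x t0 \<le> 1"
  define e where "e = pos x t0 - 1"
  have e: "e > 0" using \<open>\<not> pos x t0 \<le> 1\<close> by (simp add: e_def)
  obtain B where B: "\<And>t. \<bar>pos x t\<bar> \<le> B"
    using pos_bounded[OF x] by blast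
  \<comment> \<open>Time is reversed, so that the excess over 1 grows.\<close>
  define z where "z = (\<lambda>t. pos x (- t) - 1)"
  define l where "l = (\<lambda>t. (a (- t) - r (- t)) * pos x (- t))"
  have dz: "(z has_real_derivative - rate x (- t)) (at t)" for t
    unfolding z_def
    by (rule derivative_eq_intros has_real_derivative_reflect pos_deriv[OF x] refl)+ simp
  have dz_ge: "l t * z t \<le> - rate x (- t)" for t
    using gap_pos[of "- t"] q_le_p[of "- t"] by (simp add: z_def l_def algebra_simps)
  have cl: "continuous_on UNIV l"
    unfolding l_def
    by (intro continuous_intros continuous_on_compose2[OF pos_continuous[OF x, of UNIV]]
        continuous_on_compose2[OF global_solution_continuous[OF a, of UNIV]]
        continuous_on_compose2[OF global_solution_continuous[OF r, of UNIV]]) auto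
  have z0: "z (- t0) = e" by (simp add: z_def e_def)
  have zpos: "z t > 0" if t: "- t0 \<le> t" for t
  proof -
    obtain C where "C > 0" "C * z (- t0) \<le> z t"
      using linear_lower_bound[OF dz dz_ge cl t] by blast
    then show ?thesis
      using z0 e mult_pos_pos[of C e] by (metis less_le_trans)
  qed
  have l_ge: "\<delta> \<le> l t" if "- t0 \<le> t" for t
    using mult_mono[of \<delta> "a (- t) - r (- t)" 1 "pos x (- t)"] \<delta>(1) \<delta>(2)[of "- t"] zpos[OF that]
      gap_pos[of "- t"]
    by (simp add: l_def z_def)
  have zmono: "e \<le> z t" if "- t0 \<le> t" for t
  proof -
    have "z (- t0) \<le> z t"
    proof (rule DERIV_nonneg_imp_nondecreasing[OF that])
      fix s assume s: "- t0 \<le> s"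
      have "0 \<le> l s * z s"
        using l_ge[OF s] zpos[OF s] \<delta>(1) by (intro mult_nonneg_nonneg) auto
      then show "\<exists>y. (z has_real_derivative y) (at s) \<and> 0 \<le> y"
        using dz[of s] dz_ge[of s] by (meson order_trans)
    qed
    then show ?thesis using z0 by simp
  qed
  show False
  proof (rule derivative_ge_pos_unbounded[of "- t0" z])
    fix t assume t: "- t0 \<le> t"
    show "(z has_real_derivative - rate x (- t)) (at t)" by (rule dz)
    have "\<delta> * e \<le> l t * z t"
      using l_ge[OF t] zmono[OF t] \<delta>(1) e by (intro mult_mono) auto
    then show "\<delta> * e \<le> - rate x (- t)"
      using dz_ge[of t] by linarith
    show "z t \<le> B"
      using B[of "- t"] by (simp add: z_def)
  qed (use \<delta>(1) e in simp)
qed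

lemma pos_ge_0:
  assumes "global_solution (riccati q) x"
  shows "0 \<le> pos x t"
  using perturbed_riccati.pos_le_1[OF reflected riccati_reflect[OF assms], of "- t"]
  by (simp add: reflected_pos)

text \<open>The constant \<open>3/32 \<delta>\<close> is half of \<open>(1/4) (3/4) \<delta>\<close>, a lower bound of the logistic term on \<open>[1/4, 3/4]\<close>.\<close>

lemma perturbation_eventually_small:
  obtains T where "\<And>t. T \<le> t \<Longrightarrow> (p t - q t) / (a t - r t) \<le> 3 / 32 * \<delta>"
proof -
  have "\<forall>\<^sub>F t in at_infinity. p t - q t < 3 / 32 * \<delta> * \<delta>"
    using order_tendstoD(2)[OF decay, of "3 / 32 * \<delta> * \<delta>"] \<delta>(1) by simp
  then obtain T where T: "\<And>t. T \<le> norm t \<Longrightarrow> p t - q t < 3 / 32 * \<delta> * \<delta>"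
    by (auto simp: eventually_at_infinity)
  have "(p t - q t) / (a t - r t) \<le> 3 / 32 * \<delta>" if "T \<le> t" for t
  proof -
    have "p t - q t \<le> 3 / 32 * \<delta> * \<delta>"
      using T[of t] that by force
    also have "\<dots> \<le> 3 / 32 * \<delta> * (a t - r t)"
      using \<delta>(1) \<delta>(2)[of t] by (intro mult_left_mono) auto
    finally show ?thesis
      using gap_pos[of t] by (simp add: divide_simps)
  qed
  then show ?thesis using that by blast
qed

text \<open>Positions \<open>c\<close> with \<open>c (1 - c) = 3/16\<close>, that is 1/4 and 3/4, are barriers from below once the
  perturbation is small.\<close>

lemma barrier:
  assumes x: "global_solution (riccati q) x"
    and small: "\<And>t. T \<le> t \<Longrightarrow> (p t - q t) / (a t - r t) \<le> 3 / 32 * \<delta>"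
    and c: "c * (1 - c) = 3 / 16" and "T \<le> t0" "c \<le> pos x t0" "t0 \<le> t1"
  shows "c \<le> pos x t1"
proof -
  let ?k = "\<lambda>t. (a t - r t) * (1 - c - pos x t)"
  have d: "((\<lambda>t. pos x t - c) has_real_derivative rate x t) (at t)" for t
    by (rule derivative_eq_intros pos_deriv[OF x] refl)+ simp
  have le: "?k t * (pos x t - c) \<le> rate x t" if "t0 \<le> t" for t
  proof -
    have "(1 - c - pos x t) * (pos x t - c) = pos x t * (1 - pos x t) - c * (1 - c)"
      by (simp add: algebra_simps)
    then have "?k t * (pos x t - c) = (a t - r t) * (pos x t * (1 - pos x t) - 3 / 16)"
      by (simp add: c mult.assoc)
    moreover have "(p t - q t) / (a t - r t) \<le> 3 / 32 * \<delta>"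
      using small[of t] that \<open>T \<le> t0\<close> by simp
    then have "(p t - q t) / (a t - r t) \<le> (a t - r t) * (3 / 16)"
      using \<delta>(1) \<delta>(2)[of t] by argo
    ultimately show ?thesis
      by (simp add: right_diff_distrib)
  qed
  have cont: "continuous_on UNIV ?k"
    by (intro continuous_on_mult gap_continuous continuous_intros pos_continuous[OF x])
  obtain C where C: "C > 0" "C * (pos x t0 - c) \<le> pos x t1 - c"
    using linear_lower_bound[OF d le cont \<open>t0 \<le> t1\<close>] by blast
  have "0 \<le> C * (pos x t0 - c)"
    using \<open>c \<le> pos x t0\<close> C(1) by (intro mult_nonneg_nonneg) auto
  then show ?thesis
    using C(2) by linarith
qed

text \<open>A solution cannot remain in the middle zone, where it rises at a definite rate.\<close>

lemma low_or_eventually_high: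
  assumes x: "global_solution (riccati q) x"
    and small: "\<And>t. T \<le> t \<Longrightarrow> (p t - q t) / (a t - r t) \<le> 3 / 32 * \<delta>"
  shows "(\<forall>t\<ge>T. pos x t < 1 / 4) \<or> (\<exists>S. \<forall>t\<ge>S. 3 / 4 \<le> pos x t)"
proof (rule disjCI)
  assume nhigh: "\<not> (\<exists>S. \<forall>t\<ge>S. 3 / 4 \<le> pos x t)"
  show "\<forall>t\<ge>T. pos x t < 1 / 4"
  proof (rule ccontr)
    assume "\<not> (\<forall>t\<ge>T. pos x t < 1 / 4)"
    then obtain t0 where t0: "T \<le> t0" "1 / 4 \<le> pos x t0"
      by force
    have ge: "1 / 4 \<le> pos x t" if "t0 \<le> t" for t
      by (rule barrier[OF x small, where T = T and ?t0.0 = t0]) (use t0 that in simp_all)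
    have lt: "pos x t < 3 / 4" if "t0 \<le> t" for t
    proof (rule ccontr)
      assume high: "\<not> pos x t < 3 / 4"
      have "3 / 4 \<le> pos x s" if "t \<le> s" for s
        by (rule barrier[OF x small, where T = T and ?t0.0 = t])
          (use t0 high \<open>t0 \<le> t\<close> that in simp_all)
      then show False using nhigh by blast
    qed
    show False
    proof (rule derivative_ge_pos_unbounded[of t0 "pos x"])
      fix t assume t: "t0 \<le> t"
      show "(pos x has_real_derivative rate x t) (at t)"
        by (rule pos_deriv[OF x])
      have "0 \<le> (pos x t - 1 / 4) * (3 / 4 - pos x t)"
        using ge[OF t] lt[OF t] by (intro mult_nonneg_nonneg) auto
      then have "3 / 16 \<le> pos x t * (1 - pos x t)"
        by (simp add: algebra_simps)
      then have "\<delta> * (3 / 16) \<le> (a t - r t) * (pos x t * (1 - pos x t))"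
        using \<delta>(1) \<delta>(2)[of t] by (intro mult_mono) auto
      then show "3 / 32 * \<delta> \<le> rate x t"
        using small[of t] t t0 by simp
      show "pos x t \<le> 3 / 4"
        using lt[OF t] by simp
    qed (use \<delta>(1) in simp)
  qed
qed

lemma pos_difference_deriv:
  assumes "global_solution (riccati q) x" "global_solution (riccati q) y"
  shows "((\<lambda>t. pos y t - pos x t) has_real_derivative
    (a t - r t) * (1 - pos x t - pos y t) * (pos y t - pos x t)) (at t)"
  by (rule derivative_eq_intros pos_deriv assms refl)+ (simp add: algebra_simps)

text \<open>Two solutions in the low zone would separate at an exponential rate, since the perturbation
  cancels in their difference.\<close>

lemma upper_eventually_high:
  assumes x: "global_solution (riccati q) x" and y: "global_solution (riccati q) y"
    and less: "\<And>t. x t < y t"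
  shows "\<exists>S. \<forall>t\<ge>S. 3 / 4 \<le> pos y t"
proof (rule ccontr)
  assume nhigh: "\<not> (\<exists>S. \<forall>t\<ge>S. 3 / 4 \<le> pos y t)"
  obtain T where small: "\<And>t. T \<le> t \<Longrightarrow> (p t - q t) / (a t - r t) \<le> 3 / 32 * \<delta>"
    using perturbation_eventually_small by blast
  have low: "pos y t < 1 / 4" if "T \<le> t" for t
    using low_or_eventually_high[OF y small, where T = T] nhigh that by blast
  define n where "n = (\<lambda>t. pos y t - pos x t)"
  have npos: "n t > 0" for t
    using less[of t] by (simp add: n_def pos_less_iff)
  let ?n' = "\<lambda>t. (a t - r t) * (1 - pos x t - pos y t) * n t"
  have dn: "(n has_real_derivative ?n' t) (at t)" for t
    unfolding n_def by (rule pos_difference_deriv[OF x y])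
  have n'_ge: "\<delta> * (1 / 2) * n t \<le> ?n' t" if "T \<le> t" for t
  proof (rule mult_right_mono)
    have "1 / 2 \<le> 1 - pos x t - pos y t"
      using low[OF that] npos[of t] unfolding n_def by linarith
    then show "\<delta> * (1 / 2) \<le> (a t - r t) * (1 - pos x t - pos y t)"
      by (rule mult_mono[OF \<delta>(2) _ less_imp_le[OF gap_pos]]) simp
  qed (use npos[of t] in simp)
  have nmono: "n T \<le> n t" if "T \<le> t" for t
  proof (rule DERIV_nonneg_imp_nondecreasing[OF that])
    fix s assume s: "T \<le> s"
    have "0 \<le> \<delta> * (1 / 2) * n s"
      using npos[of s] \<delta>(1) by simp
    then show "\<exists>z. (n has_real_derivative z) (at s) \<and> 0 \<le> z"
      using dn[of s] n'_ge[OF s] by (meson order_trans)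
  qed
  show False
  proof (rule derivative_ge_pos_unbounded[of T n, OF dn])
    fix t assume t: "T \<le> t"
    have "\<delta> * (1 / 2) * n T \<le> \<delta> * (1 / 2) * n t"
      using nmono[OF t] \<delta>(1) by (intro mult_left_mono) auto
    then show "\<delta> * (1 / 2) * n T \<le> ?n' t"
      using n'_ge[OF t] by linarith
    show "n t \<le> 1"
      using pos_le_1[OF y, of t] pos_ge_0[OF x, of t] by (simp add: n_def)
  qed (use npos[of T] \<delta>(1) in simp)
qed

text \<open>If the lowest solution below \<open>y\<close> were eventually high, then its distance \<open>n\<close> from \<open>y\<close>, measured
  in positions, would contract: \<open>n' \<le> - (\<delta>/2) n\<close>.  The distance would thus be integrable, which keeps the
  factor \<open>H\<close> away from zero and contradicts that the solution is lowest.\<close>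

lemma eventually_low_solution:
  assumes x1: "global_solution (riccati q) x1" and y: "global_solution (riccati q) y"
    and less: "\<And>t. x1 t < y t"
  obtains x S where "global_solution (riccati q) x" "\<And>t. x t < y t"
    "\<And>t. S \<le> t \<Longrightarrow> pos x t \<le> 1 / 4"
proof -
  obtain x H where x: "global_solution (riccati q) x" and xy: "\<And>t. x t < y t"
    and H: "\<And>t. H t > 0" and dH: "\<And>t. (H has_real_derivative - (y t - x t) * H t) (at t)"
    and inf: "\<And>e. e > 0 \<Longrightarrow> \<exists>t. H t < e"
    using riccati_lowest_solution[OF x1 y less] by metis
  obtain T where small: "\<And>t. T \<le> t \<Longrightarrow> (p t - q t) / (a t - r t) \<le> 3 / 32 * \<delta>"
    using perturbation_eventually_small by blast
  have False if "\<forall>t\<ge>S. 3 / 4 \<le> pos x t" for S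
  proof -
    obtain D where D: "D > 0" "\<And>t. a t - r t \<le> D"
      using gap_bounded by blast
    define n where "n = (\<lambda>t. pos y t - pos x t)"
    have npos: "n t > 0" for t
      using xy[of t] by (simp add: n_def pos_less_iff)
    let ?n' = "\<lambda>t. (a t - r t) * (1 - pos x t - pos y t) * n t"
    have dn: "(n has_real_derivative ?n' t) (at t)" for t
      unfolding n_def by (rule pos_difference_deriv[OF x y])
    have n'_le: "\<delta> * (1 / 2) * n t \<le> - ?n' t" if "S \<le> t" for t
    proof -
      have "3 / 4 \<le> pos x t" "3 / 4 \<le> pos y t"
        using \<open>\<forall>t\<ge>S. 3 / 4 \<le> pos x t\<close> that npos[of t] by (auto simp: n_def dest!: spec[of _ t])
      then have "1 / 2 \<le> pos x t + pos y t - 1"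
        by linarith
      then have "\<delta> * (1 / 2) \<le> (a t - r t) * (pos x t + pos y t - 1)"
        by (rule mult_mono[OF \<delta>(2) _ less_imp_le[OF gap_pos]]) simp
      then have "\<delta> * (1 / 2) * n t \<le> (a t - r t) * (pos x t + pos y t - 1) * n t"
        using npos[of t] by (intro mult_right_mono) auto
      then show ?thesis
        by (simp add: algebra_simps)
    qed
    have dist: "y t - x t = (a t - r t) * n t" for t
      by (simp add: n_def gap_mult_pos_difference)
    \<comment> \<open>With this constant, \<open>ln H - c n\<close> is nondecreasing: \<open>(ln H)' = - (y - x) \<ge> - D n \<ge> c n'\<close>.\<close>
    define c where "c = 2 * D / \<delta>"
    have c: "c > 0"
      using D(1) \<delta>(1) by (simp add: c_def)
    have mono: "ln (H S) - c * n S \<le> ln (H t) - c * n t" if "S \<le> t" for t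
    proof (rule DERIV_nonneg_imp_nondecreasing[OF that])
      fix s assume s: "S \<le> s"
      have "((\<lambda>t. ln (H t) - c * n t) has_real_derivative - (y s - x s) - c * ?n' s) (at s)"
        by (rule derivative_eq_intros dH dn refl H)+ (use H[of s] in simp)
      moreover have "y s - x s \<le> D * n s"
        unfolding dist using D(2)[of s] npos[of s] by (intro mult_right_mono) auto
      moreover have "D * n s = c * (\<delta> * (1 / 2) * n s)"
        using \<delta>(1) by (simp add: c_def)
      moreover have "c * (\<delta> * (1 / 2) * n s) \<le> c * - ?n' s"
        using n'_le[OF s] c by (intro mult_left_mono) auto
      ultimately show "\<exists>z. ((\<lambda>t. ln (H t) - c * n t) has_real_derivative z) (at s) \<and> 0 \<le> z"
        by (intro exI[of _ "- (y s - x s) - c * ?n' s"]) simp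
    qed
    have antimono: "H t \<le> H s" if "s \<le> t" for s t
    proof (rule DERIV_nonpos_imp_nonincreasing[OF that])
      fix l
      have "- (y l - x l) * H l \<le> 0"
        using xy[of l] H[of l] by (intro mult_nonpos_nonneg) auto
      then show "\<exists>z. (H has_real_derivative z) (at l) \<and> z \<le> 0"
        using dH by blast
    qed
    define e where "e = exp (ln (H S) - c * n S)"
    have "e \<le> H t" for t
    proof -
      have "ln (H S) - c * n S \<le> ln (H (max S t)) - c * n (max S t)"
        by (rule mono) simp
      also have "\<dots> \<le> ln (H (max S t))"
        using c npos[of "max S t"] by simp
      finally have "e \<le> exp (ln (H (max S t)))"
        by (simp add: e_def)
      also have "\<dots> \<le> H t"
        using H antimono[of t "max S t"] by simp
      finally show ?thesis .
    qed
    moreover have "e > 0" by (simp add: e_def)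
    ultimately show False
      using inf[of e] by (meson not_less)
  qed
  then have "pos x t < 1 / 4" if "T \<le> t" for t
    using low_or_eventually_high[OF x small, where T = T] that by blast
  then show ?thesis
    using that[OF x xy, of T] by (meson less_imp_le)
qed

text \<open>First the lower of the two given solutions is replaced by one that is low in the future, then
  the upper one by one that is high in the past.  The other two asymptotic positions are automatic,
  and between the two ends a positive continuous function on a compact interval has a positive
  minimum.\<close>

lemma separated_pair:
  assumes x1: "global_solution (riccati q) x1" and x2: "global_solution (riccati q) x2"
    and less: "\<And>t. x1 t < x2 t"
  obtains x y \<epsilon> where "global_solution (riccati q) x" "global_solution (riccati q) y"
    "\<epsilon> > 0" "\<And>t. \<epsilon> \<le> y t - x t"
proof -
  obtain x S1 where x: "global_solution (riccati q) x" and "\<And>t. x t < x2 t"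
    and S1: "\<And>t. S1 \<le> t \<Longrightarrow> pos x t \<le> 1 / 4"
    using eventually_low_solution[OF x1 x2 less] by metis
  then have "- x2 (- t) < - x (- t)" for t by simp
  from perturbed_riccati.eventually_low_solution[OF reflected riccati_reflect[OF x2]
      riccati_reflect[OF x] this]
  obtain y' S2 where y': "global_solution (riccati (\<lambda>t. q (- t))) y'" "\<And>t. y' t < - x (- t)"
    and S2: "\<And>t. S2 \<le> t \<Longrightarrow> perturbed_riccati.pos (\<lambda>t. - a (- t)) (\<lambda>t. - r (- t)) y' t \<le> 1 / 4"
    by metis
  define y where "y = (\<lambda>t. - y' (- t))"
  have y: "global_solution (riccati q) y"
    using riccati_reflect[OF y'(1)] by (simp add: y_def)
  have y'_eq: "y' = (\<lambda>t. - y (- t))"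
    by (simp add: y_def)
  have xy: "x t < y t" for t
    using y'(2)[of "- t"] by (simp add: y_def)
  have S2': "3 / 4 \<le> pos y t" if "t \<le> - S2" for t
    using S2[of "- t"] that unfolding y'_eq reflected_pos by simp
  obtain S3 where S3: "\<And>t. S3 \<le> t \<Longrightarrow> 3 / 4 \<le> pos y t"
    using upper_eventually_high[OF x y xy] by blast
  have "- y (- t) < - x (- t)" for t
    using xy by simp
  then obtain S4 where
    S4: "\<And>t. S4 \<le> t \<Longrightarrow> 3 / 4 \<le> perturbed_riccati.pos (\<lambda>t. - a (- t)) (\<lambda>t. - r (- t)) (\<lambda>t. - x (- t)) t"
    using perturbed_riccati.upper_eventually_high[OF reflected riccati_reflect[OF y] riccati_reflect[OF x]]
    by blast
  have S4': "pos x t \<le> 1 / 4" if "t \<le> - S4" for t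
    using S4[of "- t"] that unfolding reflected_pos by simp
  define S where "S = Max {0, S1, S2, S3, S4}"
  have S: "0 \<le> S" "S1 \<le> S" "S2 \<le> S" "S3 \<le> S" "S4 \<le> S"
    by (auto simp: S_def)
  have far: "\<delta> / 2 \<le> y t - x t" if "t \<le> - S \<or> S \<le> t" for t
  proof -
    have "1 / 2 \<le> pos y t - pos x t"
      using that S1[of t] S2'[of t] S3[of t] S4'[of t] S by fastforce
    then have "\<delta> * (1 / 2) \<le> (a t - r t) * (pos y t - pos x t)"
      using \<delta>(1) \<delta>(2)[of t] by (intro mult_mono) auto
    also have "\<dots> = y t - x t"
      by (rule gap_mult_pos_difference)
    finally show ?thesis by simp
  qed
  have "continuous_on {- S..S} (\<lambda>t. y t - x t)"
    by (intro continuous_intros global_solution_continuous[OF x] global_solution_continuous[OF y])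
  then obtain t0 where "\<forall>t\<in>{- S..S}. y t0 - x t0 \<le> y t - x t"
    using continuous_attains_inf[of "{- S..S}" "\<lambda>t. y t - x t"] S(1) by auto
  then have t0: "y t0 - x t0 \<le> y t - x t" if "- S \<le> t" "t \<le> S" for t
    using that by simp
  have "min (\<delta> / 2) (y t0 - x t0) \<le> y t - x t" for t
    using far[of t] t0[of t] by fastforce
  then show ?thesis
    using that[OF x y, of "min (\<delta> / 2) (y t0 - x t0)"] xy[of t0] \<delta>(1) by simp
qed

end

section \<open>The transition equation\<close>

theorem theorem4p3:
  fixes p :: "real \<Rightarrow> real" and c :: real
  assumes "bounded (range p)"
    and "uniformly_continuous_on UNIV p"
    and "card {b. hyperbolic_solution (\<lambda>t x. - x\<^sup>2 + p t) b} = 2"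
    and "c > 0"
  defines "h \<equiv> \<lambda>t y. - (y - 2 / pi * arctan (c * t))\<^sup>2 + p t"
  shows "(\<exists>b1 b2. b1 \<noteq> b2 \<and> hyperbolic_solution h b1 \<and> hyperbolic_solution h b2) \<or>
         (\<exists>!b. bounded_solution h b) \<or>
         \<not> (\<exists>b. bounded_solution h b)"
proof -
  define \<Gamma> where "\<Gamma> = (\<lambda>t. 2 / pi * arctan (c * t))"
  define g where "g = (\<lambda>t. 2 / pi * (c / (1 + (c * t)\<^sup>2)))"
  define q where "q = (\<lambda>t. p t - g t)"
  have h: "h = (\<lambda>t y. - (y - \<Gamma> t)\<^sup>2 + p t)"
    by (simp add: h_def \<Gamma>_def)
  have d\<Gamma>: "(\<Gamma> has_real_derivative g t) (at t)" for t
    unfolding \<Gamma>_def g_def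
    by (rule derivative_eq_intros refl)+ (simp add: field_simps)
  have translate: "global_solution h b \<longleftrightarrow> global_solution (riccati q) (\<lambda>t. b t - \<Gamma> t)" for b
  proof
    assume "global_solution h b"
    then have b: "(b has_real_derivative - (b t - \<Gamma> t)\<^sup>2 + p t) (at t)" for t
      by (simp add: global_solution_def h)
    show "global_solution (riccati q) (\<lambda>t. b t - \<Gamma> t)"
      using DERIV_diff[OF b d\<Gamma>] by (simp add: global_solution_def q_def algebra_simps)
  next
    assume *: "global_solution (riccati q) (\<lambda>t. b t - \<Gamma> t)"
    show "global_solution h b"
      using DERIV_add[OF riccati_deriv[OF *] d\<Gamma>] by (simp add: global_solution_def q_def h)
  qed
  have deriv_h: "deriv (h t) y = - 2 * (y - \<Gamma> t)" for t y
    unfolding h by (rule DERIV_imp_deriv) (auto intro!: derivative_eq_intros)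
  have g_pos: "0 \<le> g t" and g_le: "g t \<le> 2 / pi * c" for t
  proof -
    have "1 \<le> 1 + (c * t)\<^sup>2" by simp
    then have "c / (1 + (c * t)\<^sup>2) \<le> c / 1"
      using \<open>c > 0\<close> by (intro frac_le) auto
    then show "g t \<le> 2 / pi * c"
      unfolding g_def by (intro mult_left_mono) auto
    show "0 \<le> g t"
      using \<open>c > 0\<close> by (auto simp: g_def intro!: mult_nonneg_nonneg divide_nonneg_nonneg)
  qed
  have "(g \<longlongrightarrow> 0) at_top" "(g \<longlongrightarrow> 0) at_bot"
    unfolding g_def using \<open>c > 0\<close> by real_asymp+
  then have g_decay: "(g \<longlongrightarrow> 0) at_infinity"
    by (simp add: at_infinity_eq_at_top_bot filterlim_sup)
  have "bounded (range g)"
    using g_pos g_le by (auto simp: bounded_iff intro!: exI[of _ "2 / pi * c"])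
  then have q_bounded: "bounded (range q)"
    using bounded_minus_comp[OF assms(1)] by (simp add: q_def)
  have two_hyperbolic: "\<exists>b1 b2. b1 \<noteq> b2 \<and> hyperbolic_solution h b1 \<and> hyperbolic_solution h b2"
    if b: "global_solution h b1" "global_solution h b2" and lt: "b1 t0 < b2 t0" for b1 b2 t0
  proof -
    obtain u v where "u \<noteq> v" and hyp: "hyperbolic_solution (riccati p) u" "hyperbolic_solution (riccati p) v"
      using assms(3) by (auto simp: card_2_iff set_eq_iff)
    then obtain s where "u s \<noteq> v s" by blast
    then obtain r a where hr: "hyperbolic_solution (riccati p) r" and ha: "hyperbolic_solution (riccati p) a"
      and "r s < a s"
      using hyp by (metis linorder_neqE_linordered_idom)
    then have ra: "global_solution (riccati p) r" "global_solution (riccati p) a"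
      by (auto simp: hyperbolic_solution_def)
    obtain \<delta> where "\<delta> > 0" "\<And>t. \<delta> \<le> a t - r t"
      using hyperbolic_solutions_separated[OF hr ha riccati_order_preserved[OF ra \<open>r s < a s\<close>] assms(1)]
      by blast
    then interpret perturbed_riccati p q r a \<delta>
      using ra assms(1) q_bounded g_pos g_decay by unfold_locales (auto simp: q_def)
    note b' = b[unfolded translate]
    have "b1 t - \<Gamma> t < b2 t - \<Gamma> t" for t
      using riccati_order_preserved[OF b', of t0] lt by simp
    then obtain x y \<epsilon> where x: "global_solution (riccati q) x" and y: "global_solution (riccati q) y"
      and \<epsilon>: "\<epsilon> > 0" "\<And>t. \<epsilon> \<le> y t - x t"
      using separated_pair[OF b'] by metis
    obtain M N where "\<And>t. \<bar>x t\<bar> \<le> M" "\<And>t. \<bar>y t\<bar> \<le> N"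
      using riccati_global_bounded[OF x q_bounded] riccati_global_bounded[OF y q_bounded] by metis
    then have D: "y t - x t \<le> M + N" for t
      by (smt (verit))
    have "hyperbolic_solution h (\<lambda>t. x t + \<Gamma> t) \<and> hyperbolic_solution h (\<lambda>t. y t + \<Gamma> t)"
      by (rule separated_solutions_hyperbolic[OF x y \<epsilon> D])
        (use x y in \<open>simp_all add: translate deriv_h\<close>)
    moreover have "(\<lambda>t. x t + \<Gamma> t) \<noteq> (\<lambda>t. y t + \<Gamma> t)"
      using \<epsilon>(1) \<epsilon>(2)[of 0] by (auto dest!: fun_cong[of _ _ 0])
    ultimately show ?thesis by blast
  qed
  show ?thesis
  proof (cases "\<exists>b1 b2. bounded_solution h b1 \<and> bounded_solution h b2 \<and> b1 \<noteq> b2")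
    case True
    then obtain b1 b2 where b: "global_solution h b1" "global_solution h b2" and "b1 \<noteq> b2"
      by (auto simp: bounded_solution_def)
    then obtain t0 where "b1 t0 \<noteq> b2 t0" by blast
    then consider "b1 t0 < b2 t0" | "b2 t0 < b1 t0" by linarith
    then show ?thesis
      using two_hyperbolic b by cases blast+
  next
    case False
    then show ?thesis by blast
  qed
qed

end
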